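(* Let $0\le p<\frac12$. Assume either that the maximum size of a cluster is at most $\frac{4n}{k}$, or that the minimum size of a cluster is at least $\frac{n}{20k}$. For clusterings satisfying either of these conditions, any (randomized) algorithm using the faulty oracle with error probability $p$ and no side information must make $\Omega\Big(\frac{nk}{D(p\|1-p)}\Big)$ queries to recover the correct clusters with probability $0.9$ when $p>0$; and when $p=0$, any (randomized) algorithm must make $\Omega(nk)$ queries to recover the correct clusters with probability $0.9$.
   Context: Clustering problem: the vertex set is $V=[n]$, partitioned into $k$ unknown nonempty clusters. Faulty oracle with error probability $p$: a query is a pair $\{u,v\}$; if $u,v$ are in the same cluster the answer is $+1$ with probability $1-p$ and $-1$ with probability $p$, and if they are in different clusters the answer is $-1$ with probability $1-p$ and $+1$ with probability $p$, independently across queries; each pair may be queried at most once (no resampling); queries may be adaptive. For Bernoulli parameters, $D(p\|q)=p\ln\frac pq+(1-p)\ln\frac{1-p}{1-q}$, so $D(p\|1-p)=(1-2p)\ln\frac{1-p}{p}$.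
   Formalization: The number of clusters is restricted to 2 ≤ k < n, because for k = 1 or k = n there is only one clustering with k clusters, so an algorithm making no queries recovers it and the claimed bound fails. *)

theory Defs
  imports "HOL-Probability.Probability" "HOL-Library.Disjoint_Sets"
begin

definition clusterings :: "nat \<Rightarrow> nat \<Rightarrow> nat set set set" where
  "clusterings n k = {P. partition_on {1..n} P \<and> card P = k}"

definition max_bounded_clusterings :: "nat \<Rightarrow> nat \<Rightarrow> nat set set set" where
  "max_bounded_clusterings n k =
     {P \<in> clusterings n k. real (Max (card ` P)) \<le> 4 * real n / real k}"

definition min_bounded_clusterings :: "nat \<Rightarrow> nat \<Rightarrow> nat set set set" where
  "min_bounded_clusterings n k =
     {P \<in> clusterings n k. real (Min (card ` P)) \<ge> real n / (20 * real k)}"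

definition same_cluster :: "nat set set \<Rightarrow> nat \<Rightarrow> nat \<Rightarrow> bool" where
  "same_cluster P u v \<longleftrightarrow> (\<exists>C\<in>P. u \<in> C \<and> v \<in> C)"

text \<open>The answers $+1$ and $-1$ of the oracle are encoded as \<^term>\<open>True\<close> and \<^term>\<open>False\<close>.\<close>

definition faulty_oracle :: "real \<Rightarrow> nat set set \<Rightarrow> nat \<Rightarrow> nat \<Rightarrow> bool pmf" where
  "faulty_oracle p P u v = bernoulli_pmf (if same_cluster P u v then 1 - p else p)"

text \<open>A deterministic adaptive algorithm is a decision tree: it either stops and outputs a guess
  for the set of clusters, or queries a pair and continues depending on the answer.\<close>

datatype query_tree =
    Output "nat set set"
  | Query nat nat "bool \<Rightarrow> query_tree"

text \<open>\<open>admissible n S t\<close>: the tree only queries pairs of distinct elements of \<open>{1..n}\<close>, never one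
  of the pairs in \<open>S\<close>, and never the same pair twice along a branch.\<close>

primrec admissible :: "nat \<Rightarrow> nat set set \<Rightarrow> query_tree \<Rightarrow> bool" where
  "admissible n S (Output C) \<longleftrightarrow> True"
| "admissible n S (Query u v g) \<longleftrightarrow>
     u \<in> {1..n} \<and> v \<in> {1..n} \<and> u \<noteq> v \<and> {u, v} \<notin> S \<and>
     (\<forall>a. admissible n (insert {u, v} S) (g a))"

text \<open>Joint law of the output and the number of queries made. Drawing a fresh answer at every
  node models independent oracle errors, since admissible trees never repeat a pair.\<close>

primrec run_tree :: "real \<Rightarrow> nat set set \<Rightarrow> query_tree \<Rightarrow> (nat set set \<times> nat) pmf" where
  "run_tree p P (Output C) = return_pmf (C, 0)"
| "run_tree p P (Query u v g) =
     bind_pmf (faulty_oracle p P u v)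
       (\<lambda>a. map_pmf (\<lambda>(C, m). (C, Suc m)) (run_tree p P (g a)))"

text \<open>A randomized algorithm is a probability distribution over deterministic ones.\<close>

definition randomized_algorithm :: "nat \<Rightarrow> query_tree pmf \<Rightarrow> bool" where
  "randomized_algorithm n A \<longleftrightarrow> (\<forall>t \<in> set_pmf A. admissible n {} t)"

definition run_algorithm :: "real \<Rightarrow> nat set set \<Rightarrow> query_tree pmf \<Rightarrow> (nat set set \<times> nat) pmf" where
  "run_algorithm p P A = bind_pmf A (run_tree p P)"

definition success_prob :: "real \<Rightarrow> nat set set \<Rightarrow> query_tree pmf \<Rightarrow> real" where
  "success_prob p P A = measure_pmf.prob (run_algorithm p P A) {(C, m). C = P}"

definition expected_queries :: "real \<Rightarrow> nat set set \<Rightarrow> query_tree pmf \<Rightarrow> real" where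
  "expected_queries p P A = measure_pmf.expectation (run_algorithm p P A) (\<lambda>(C, m). real m)"

definition KL_bernoulli :: "real \<Rightarrow> real \<Rightarrow> real" where
  "KL_bernoulli p q = p * ln (p / q) + (1 - p) * ln ((1 - p) / (1 - q))"

end

theory Submission
  imports Defs
begin

text \<open>Write \<open>\<delta> = 1 - 2 p\<close>, so that \<open>D(p\<parallel>1-p) \<ge> \<delta>\<^sup>2\<close>; it suffices to prove an
  \<open>\<Omega>(n k / \<delta>\<^sup>2)\<close> bound for all \<open>0 \<le> p < 1/2\<close>.

  The core is a search problem: \<open>m\<close> clusterings each differ from a common null answer pattern on
  disjoint sets \<open>S\<^sub>j\<close> of pairs. Abort the algorithm after \<open>b\<close> queries in \<open>S = \<Union>S\<^sub>j\<close>. Under the null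
  pattern it makes at most \<open>b\<close> such queries, so an average \<open>S\<^sub>j\<close> receives only \<open>b / m\<close>, and a change of
  measure shows that for \<open>b\<close> a small multiple of \<open>m / \<delta>\<^sup>2\<close> the aborted algorithm cannot tell most
  alternatives from the null pattern. By Markov's inequality the original algorithm makes
  \<open>\<Omega>(m / \<delta>\<^sup>2)\<close> queries in \<open>S\<close> on average over the alternatives.

  If \<open>n < 5 k / 4\<close>, the alternatives are the choices of one cluster of size two among \<open>\<Omega>(k)\<close> vertices
  that are otherwise singletons, so \<open>m = \<Omega>(k\<^sup>2)\<close>. If \<open>n \<ge> 5 k / 4\<close>, average over all admissible
  labellings: a constant fraction of the vertices \<open>v\<close> can be moved to \<open>\<Omega>(k)\<close> other clusters, the null
  pattern isolates \<open>v\<close>, and summing the resulting \<open>\<Omega>(k / \<delta>\<^sup>2)\<close> bounds over \<open>v\<close> counts every query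
  twice.\<close>

subsection \<open>Decision trees\<close>

text \<open>The pattern \<open>r\<close> is an arbitrary relation because the null patterns used
  later need not come from a clustering with \<open>k\<close> clusters.\<close>

definition answer_prob :: "real \<Rightarrow> (nat \<Rightarrow> nat \<Rightarrow> bool) \<Rightarrow> nat \<Rightarrow> nat \<Rightarrow> real" where
  "answer_prob p r u v = (if r u v then 1 - p else p)"

text \<open>Replacing \<open>run_tree\<close> by real-valued recursions turns each probabilistic
  estimate into an induction in which a query node is a convex combination of its two
  subtrees.\<close>

primrec output_prob :: "(nat \<Rightarrow> nat \<Rightarrow> real) \<Rightarrow> nat set set \<Rightarrow> query_tree \<Rightarrow> real" where
  "output_prob w C (Output C') = of_bool (C' = C)"
| "output_prob w C (Query u v g) =
     w u v * output_prob w C (g True) + (1 - w u v) * output_prob w C (g False)"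

primrec query_count :: "(nat \<Rightarrow> nat \<Rightarrow> real) \<Rightarrow> nat set set \<Rightarrow> query_tree \<Rightarrow> real" where
  "query_count w S (Output C) = 0"
| "query_count w S (Query u v g) = of_bool ({u, v} \<in> S) +
     w u v * query_count w S (g True) + (1 - w u v) * query_count w S (g False)"

text \<open>Aborted branches output the empty set, which is never a clustering of a nonempty set.\<close>

primrec cut_off :: "nat set set \<Rightarrow> nat \<Rightarrow> query_tree \<Rightarrow> query_tree" where
  "cut_off S b (Output C) = Output C"
| "cut_off S b (Query u v g) =
     (if {u, v} \<notin> S then Query u v (\<lambda>a. cut_off S b (g a))
      else if b = 0 then Output {}
      else Query u v (\<lambda>a. cut_off S (b - 1) (g a)))"

definition unit_weights :: "(nat \<Rightarrow> nat \<Rightarrow> real) \<Rightarrow> bool" where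
  "unit_weights w \<longleftrightarrow> (\<forall>u v. 0 \<le> w u v \<and> w u v \<le> 1)"

lemma unit_weights_answer_prob:
  "0 \<le> p \<Longrightarrow> p \<le> 1 \<Longrightarrow> unit_weights (answer_prob p r)"
  by (auto simp: unit_weights_def answer_prob_def)

lemma convex_comb_mono:
  fixes x y x' y' w :: real
  assumes "0 \<le> w" "w \<le> 1" "x \<le> x'" "y \<le> y'"
  shows "w * x + (1 - w) * y \<le> w * x' + (1 - w) * y'"
  using assms by (intro add_mono mult_left_mono) auto

lemma output_prob_bounds:
  assumes "unit_weights w"
  shows "0 \<le> output_prob w C t" "output_prob w C t \<le> 1"
proof -
  have "0 \<le> output_prob w C t \<and> output_prob w C t \<le> 1"
  proof (induction t)
    case (Query u v g)
    have w: "0 \<le> w u v" "w u v \<le> 1" using assms by (auto simp: unit_weights_def)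
    show ?case
      using convex_comb_mono[OF w, of 0 "output_prob w C (g True)" 0 "output_prob w C (g False)"]
        convex_comb_mono[OF w, of "output_prob w C (g True)" 1 "output_prob w C (g False)" 1]
        Query by simp
  qed simp
  then show "0 \<le> output_prob w C t" "output_prob w C t \<le> 1" by auto
qed

lemma query_count_nonneg:
  assumes "unit_weights w"
  shows "0 \<le> query_count w S t"
proof (induction t)
  case (Query u v g)
  then show ?case using assms by (auto simp: unit_weights_def)
qed simp

lemma query_count_mono:
  assumes "unit_weights w" "S \<subseteq> S'"
  shows "query_count w S t \<le> query_count w S' t"
proof (induction t)
  case (Query u v g)
  have w: "0 \<le> w u v" "w u v \<le> 1" using assms by (auto simp: unit_weights_def)
  show ?case
    using convex_comb_mono[OF w Query[OF rangeI[of g True]] Query[OF rangeI[of g False]]] assms(2) by auto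
qed simp

text \<open>Admissible trees never repeat a pair, so each query uses up one element of the finite
  set \<open>Pow {1..n}\<close>. The bound is crude; it serves to make the query count integrable
  over a randomized algorithm.\<close>

lemma query_count_le_card:
  assumes "unit_weights w" "admissible n X t"
  shows "query_count w S t \<le> real (card (Pow {1..n} - X))"
  using assms(2)
proof (induction t arbitrary: X)
  case (Query u v g)
  have w: "0 \<le> w u v" "w u v \<le> 1" using assms by (auto simp: unit_weights_def)
  have uv: "{u, v} \<in> Pow {1..n} - X" using Query.prems by auto
  have "Pow {1..n} - insert {u, v} X = (Pow {1..n} - X) - {{u, v}}" by auto
  then have "card (Pow {1..n} - X) = Suc (card (Pow {1..n} - insert {u, v} X))"
    using card.remove[OF _ uv] by simp
  moreover have "query_count w S (g a) \<le> card (Pow {1..n} - insert {u, v} X)" for a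
    using Query.IH[OF rangeI] Query.prems unfolding admissible.simps by blast
  note convex_comb_mono[OF w this[of True] this[of False]]
  ultimately show ?case by (simp add: algebra_simps)
qed simp

text \<open>A query lies in at most one \<open>S j\<close>, so a total budget of queries is shared
  among the alternatives.\<close>

lemma sum_query_count_disjoint:
  assumes "finite J" "disjoint_family_on S J"
  shows "(\<Sum>j\<in>J. query_count w (S j) t) = query_count w (\<Union>j\<in>J. S j) t"
proof (induction t)
  case (Query u v g)
  have "(\<Sum>j\<in>J. of_bool ({u, v} \<in> S j)) = (of_bool ({u, v} \<in> (\<Union>j\<in>J. S j)) :: real)"
  proof (cases "\<exists>i\<in>J. {u, v} \<in> S i")
    case True
    then obtain i where i: "i \<in> J" "{u, v} \<in> S i" by auto
    have "(\<Sum>j\<in>J. of_bool ({u, v} \<in> S j)) = (\<Sum>j\<in>J. if j = i then 1 else (0::real))"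
      using assms(2) i by (intro sum.cong) (auto simp: disjoint_family_on_def)
    then show ?thesis using i assms(1) by auto
  qed auto
  with Query show ?case by (simp add: sum.distrib sum_distrib_left[symmetric])
qed simp

text \<open>All terms use the same weights \<open>w\<close>, so the outputs \<open>P j\<close> are
  mutually exclusive events under one law.\<close>

lemma sum_output_prob_le_1:
  assumes "unit_weights w" "finite J" "inj_on P J"
  shows "(\<Sum>j\<in>J. output_prob w (P j) t) \<le> 1"
proof (induction t)
  case (Output C)
  have "card {j \<in> J. C = P j} \<le> 1"
    using assms by (subst One_nat_def, subst card_le_Suc0_iff_eq) (auto simp: inj_on_def)
  moreover have "(\<Sum>j\<in>J. of_bool (C = P j)) = real (card {j \<in> J. C = P j})"
    using assms(2) by (simp add: of_bool_def sum.If_cases Int_def)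
  ultimately show ?case by simp
next
  case (Query u v g)
  have w: "0 \<le> w u v" "w u v \<le> 1" using assms by (auto simp: unit_weights_def)
  show ?case
    using convex_comb_mono[OF w Query[OF rangeI[of g True]] Query[OF rangeI[of g False]]]
    by (simp add: sum.distrib sum_distrib_left[symmetric])
qed

lemma admissible_cut_off: "admissible n X t \<Longrightarrow> admissible n X (cut_off S b t)"
  by (induction t arbitrary: X b) auto

lemma query_count_cut_off_le:
  assumes "unit_weights w"
  shows "query_count w S (cut_off S b t) \<le> real b"
proof (induction t arbitrary: b)
  case (Query u v g)
  have w: "0 \<le> w u v" "w u v \<le> 1" using assms by (auto simp: unit_weights_def)
  show ?case
    using convex_comb_mono[OF w Query[OF rangeI[of g True], of b] Query[OF rangeI[of g False], of b]]
      convex_comb_mono[OF w Query[OF rangeI[of g True], of "b - 1"] Query[OF rangeI[of g False], of "b - 1"]]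
    by (auto simp: algebra_simps of_nat_diff)
qed simp

text \<open>Markov's inequality for the number of queries in \<open>S\<close>.\<close>

lemma output_prob_cut_off:
  assumes "unit_weights w"
  shows "(real b + 1) * (output_prob w C t - output_prob w C (cut_off S b t)) \<le> query_count w S t"
proof (induction t arbitrary: b)
  case (Query u v g)
  let ?d = "\<lambda>b t. output_prob w C t - output_prob w C (cut_off S b t)"
  have w: "0 \<le> w u v" "w u v \<le> 1" using assms by (auto simp: unit_weights_def)
  note q = query_count_nonneg[OF assms, of S]
  have avg: "w u v * query_count w S (g True) + (1 - w u v) * query_count w S (g False) \<ge> 0"
    using w q by auto
  consider "{u, v} \<notin> S" | "{u, v} \<in> S" "b = 0" | c where "{u, v} \<in> S" "b = Suc c"
    by (cases b) auto
  then show ?case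
  proof cases
    case 1
    then show ?thesis
      using convex_comb_mono[OF w Query[OF rangeI[of g True], of b] Query[OF rangeI[of g False], of b]]
      by (simp add: algebra_simps)
  next
    case 2
    then show ?thesis
      using avg output_prob_bounds[OF assms, of C "Query u v g"]
        output_prob_bounds(1)[OF assms, of C "Output {}"]
      by (simp del: output_prob.simps)
  next
    case (3 c)
    \<comment> \<open>The subtrees only give the factor \<open>c + 1\<close>. The missing copy of
      the difference is at most 1 and is paid for by the present query, which lies in
      \<open>S\<close>.\<close>
    have "?d b (Query u v g) \<le> 1"
      using output_prob_bounds[OF assms, of C "Query u v g"]
        output_prob_bounds[OF assms, of C "cut_off S b (Query u v g)"] by linarith
    moreover have "(real c + 1) * ?d b (Query u v g) \<le>
        w u v * query_count w S (g True) + (1 - w u v) * query_count w S (g False)"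
      using convex_comb_mono[OF w Query[OF rangeI[of g True], of c] Query[OF rangeI[of g False], of c]] 3
      by (simp add: algebra_simps)
    ultimately show ?thesis
      using 3 by (simp del: output_prob.simps cut_off.simps add: algebra_simps)
  qed
qed simp

section \<open>From probability mass functions to tree recursions\<close>

lemma prob_run_tree:
  assumes "0 \<le> p" "p \<le> 1"
  shows "emeasure (run_tree p P t) {(C, m). C = D} =
    ennreal (output_prob (answer_prob p (same_cluster P)) D t)"
proof (induction t)
  case (Output C)
  then show ?case by (simp add: indicator_def)
next
  case (Query u v g)
  let ?w = "answer_prob p (same_cluster P)"
  have w: "0 \<le> ?w u v" "?w u v \<le> 1" using assms by (auto simp: answer_prob_def)
  note o = output_prob_bounds(1)[OF unit_weights_answer_prob[OF assms]]
  have "(\<lambda>(C, m). (C, Suc m)) -` {(C, m). C = D} = {(C, m). C = D}" by auto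
  then have IH: "emeasure (map_pmf (\<lambda>(C, m). (C, Suc m)) (run_tree p P (g a))) {(C, m). C = D} =
      ennreal (output_prob ?w D (g a))" for a
    using Query by (simp only: emeasure_map_pmf rangeI)
  have "faulty_oracle p P u v = bernoulli_pmf (?w u v)"
    by (simp add: faulty_oracle_def answer_prob_def)
  then show ?case
    using w o by (simp add: IH ennreal_mult mult.commute del: emeasure_map_pmf)
qed

text \<open>Nonnegative integrals avoid integrability obligations in the induction;
  \<open>expected_queries_eq_expectation\<close> recovers the real expectation.\<close>

lemma nn_integral_run_tree:
  assumes "0 \<le> p" "p \<le> 1"
  shows "(\<integral>\<^sup>+x. ennreal (real (snd x)) \<partial>run_tree p P t) =
    ennreal (query_count (answer_prob p (same_cluster P)) UNIV t)"
proof (induction t)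
  case (Output C)
  then show ?case by simp
next
  case (Query u v g)
  let ?w = "answer_prob p (same_cluster P)"
  have w: "0 \<le> ?w u v" "?w u v \<le> 1" using assms by (auto simp: answer_prob_def)
  note q = query_count_nonneg[OF unit_weights_answer_prob[OF assms]]
  have "(\<integral>\<^sup>+x. ennreal (real (snd (case x of (C, m) \<Rightarrow> (C, Suc m)))) \<partial>run_tree p P (g a)) =
     ennreal (query_count ?w UNIV (g a) + 1)" for a
  proof -
    have "(\<integral>\<^sup>+x. ennreal (real (snd (case x of (C, m) \<Rightarrow> (C, Suc m)))) \<partial>run_tree p P (g a)) =
      (\<integral>\<^sup>+x. ennreal (real (snd x)) + 1 \<partial>run_tree p P (g a))"
      by (intro nn_integral_cong) (auto simp: ennreal_plus[symmetric] add.commute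
        simp del: ennreal_plus simp flip: ennreal_1)
    also have "\<dots> = ennreal (query_count ?w UNIV (g a)) + 1"
      using Query by (subst nn_integral_add) auto
    finally show ?thesis using q by (simp add: ennreal_plus)
  qed
  moreover have "faulty_oracle p P u v = bernoulli_pmf (?w u v)"
    by (simp add: faulty_oracle_def answer_prob_def)
  ultimately show ?case
    using w q
    by (simp add: ennreal_mult[symmetric] ennreal_plus[symmetric] del: ennreal_plus)
      (simp add: algebra_simps)
qed

lemma success_prob_eq_expectation:
  assumes "0 \<le> p" "p \<le> 1"
  shows "success_prob p P A =
    measure_pmf.expectation A (output_prob (answer_prob p (same_cluster P)) P)"
proof -
  have "measure_pmf.expectation A (output_prob (answer_prob p (same_cluster P)) P) =
     enn2real (\<integral>\<^sup>+t. ennreal (output_prob (answer_prob p (same_cluster P)) P t) \<partial>A)"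
    using output_prob_bounds(1)[OF unit_weights_answer_prob[OF assms]]
    by (intro integral_eq_nn_integral) auto
  then show ?thesis
    by (simp add: success_prob_def run_algorithm_def measure_def prob_run_tree[OF assms])
qed

lemma expected_queries_eq_expectation:
  assumes "0 \<le> p" "p \<le> 1"
  shows "expected_queries p P A =
    measure_pmf.expectation A (query_count (answer_prob p (same_cluster P)) UNIV)"
proof -
  have "measure_pmf.expectation A (query_count (answer_prob p (same_cluster P)) UNIV) =
     enn2real (\<integral>\<^sup>+t. ennreal (query_count (answer_prob p (same_cluster P)) UNIV t) \<partial>A)"
    using query_count_nonneg[OF unit_weights_answer_prob[OF assms]]
    by (intro integral_eq_nn_integral) auto
  also have "\<dots> = enn2real (\<integral>\<^sup>+x. ennreal (real (snd x)) \<partial>run_algorithm p P A)"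
    by (simp add: run_algorithm_def nn_integral_run_tree[OF assms])
  also have "\<dots> = measure_pmf.expectation (run_algorithm p P A) (\<lambda>x. real (snd x))"
    by (intro integral_eq_nn_integral[symmetric]) auto
  finally show ?thesis by (simp add: expected_queries_def case_prod_unfold)
qed

subsection \<open>Change of measure and the search problem\<close>

lemma ln_convex_comb_ge:
  fixes w x y :: real
  assumes "0 \<le> w" "w \<le> 1" "0 < x" "0 < y"
  shows "w * ln x + (1 - w) * ln y \<le> ln (w * x + (1 - w) * y)"
  using ln_concave assms by (simp add: concave_on_iff)

text \<open>For \<open>p \<ge> 1/4\<close> the divergence of the two answer laws is at most
  \<open>4 (1 - 2 p)\<^sup>2\<close>; for smaller \<open>p\<close> the error term already exceeds \<open>ln 4\<close>.\<close>

lemma ln_swapped_comb_ge: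
  fixes p x y :: real
  assumes p: "0 \<le> p" "p < 1 / 2" and x: "1 / 4 \<le> x" "x \<le> 1" and y: "1 / 4 \<le> y" "y \<le> 1"
  shows "p * ln x + (1 - p) * ln y - 8 * (1 - 2 * p)\<^sup>2 \<le> ln ((1 - p) * x + p * y)"
proof (cases "p < 1 / 4")
  case True
  have "(1 / 4 :: real) \<le> (1 - p) * x + p * y"
    using convex_comb_mono[of "1 - p" "1/4" x "1/4" y] p x y by (simp add: field_simps)
  then have "ln (1 / 4) \<le> ln ((1 - p) * x + p * y)" by (subst ln_le_cancel_iff) auto
  moreover have "ln (4::real) \<le> 2"
    using ln_le_minus_one[of "2::real"] ln_mult[of 2 "2::real"] by simp
  then have "ln (1 / 4 :: real) \<ge> - 2" by (simp add: ln_div)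
  moreover have "p * ln x + (1 - p) * ln y \<le> 0"
    using p x y by (intro add_nonpos_nonpos mult_nonneg_nonpos) auto
  \<comment> \<open>The error term is thus at least \<open>8 * (1 / 4) = 2\<close>, which covers
    \<open>ln 4 \<le> 2\<close>.\<close>
  moreover have "(1 / 2)\<^sup>2 \<le> (1 - 2 * p)\<^sup>2" using True by (intro power_mono) auto
  ultimately show ?thesis by (simp add: power2_eq_square)
next
  case False
  then have p': "1 / 4 \<le> p" by simp
  \<comment> \<open>Scaling \<open>x\<close> by the odds \<open>r\<close> and \<open>y\<close> by
    \<open>1 / r\<close> swaps the weights \<open>p\<close> and \<open>1 - p\<close>. In Jensen's
    inequality this costs \<open>(1 - 2 * p) * ln r\<close>, which is the divergence itself.\<close>
  define r where "r = (1 - p) / p"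
  have r: "0 < r" using p p' by (simp add: r_def)
  have "p * (x * r) + (1 - p) * (y / r) = (1 - p) * x + p * y"
    using p p' by (simp add: r_def)
  then have "p * ln (x * r) + (1 - p) * ln (y / r) \<le> ln ((1 - p) * x + p * y)"
    using ln_convex_comb_ge[of p "x * r" "y / r"] p x y r by simp
  moreover have "p * ln (x * r) + (1 - p) * ln (y / r) =
      p * ln x + (1 - p) * ln y - (1 - 2 * p) * ln r"
    using r x y by (simp add: ln_mult ln_div algebra_simps)
  moreover have "(1 - 2 * p) * ln r \<le> 8 * (1 - 2 * p)\<^sup>2"
  proof -
    have "ln r \<le> r - 1" using ln_le_minus_one r by auto
    also have "\<dots> = (1 - 2 * p) / p" using p' by (simp add: r_def field_simps)
    also have "\<dots> \<le> (1 - 2 * p) / (1 / 8)" using p p' by (intro divide_left_mono) auto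
    also have "\<dots> = 8 * (1 - 2 * p)" by simp
    finally have "(1 - 2 * p) * ln r \<le> (1 - 2 * p) * (8 * (1 - 2 * p))"
      using p by (intro mult_left_mono) auto
    then show ?thesis by (simp add: power2_eq_square algebra_simps)
  qed
  ultimately show ?thesis by linarith
qed

text \<open>A Donsker-Varadhan type inequality for the variable Z that is \<open>- ln 4\<close> on
  output \<open>C\<close> and 0 otherwise: the null mean of Z, minus a divergence, is at most the
  logarithm of the mean of exp Z. Only queries in \<open>S\<close> cost divergence, counted under
  the null law. As exp Z stays between 1/4 and 1, the cost per query is bounded even at
  \<open>p = 0\<close>, where the true divergence is infinite.\<close>

lemma change_of_measure:
  assumes p: "0 \<le> p" "p < 1 / 2" and t: "admissible n X t"
    and agree: "\<And>u v. u \<in> {1..n} \<Longrightarrow> v \<in> {1..n} \<Longrightarrow> u \<noteq> v \<Longrightarrow> {u, v} \<notin> S \<Longrightarrow> r u v = r0 u v"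
  shows "- ln 4 * output_prob (answer_prob p r0) C t
           - 8 * (1 - 2 * p)\<^sup>2 * query_count (answer_prob p r0) S t
         \<le> ln (1 - 3 / 4 * output_prob (answer_prob p r) C t)"
  using t
proof (induction t arbitrary: X)
  case (Output C')
  then show ?case by (simp add: ln_div)
next
  case (Query u v g)
  let ?w = "answer_prob p r" and ?q = "answer_prob p r0" and ?d = "8 * (1 - 2 * p)\<^sup>2"
  have W: "unit_weights ?w" "unit_weights ?q" using p unit_weights_answer_prob by auto
  have w: "0 \<le> ?q u v" "?q u v \<le> 1" "0 \<le> ?w u v" "?w u v \<le> 1"
    using W by (auto simp: unit_weights_def)
  define G where "G a = 1 - 3 / 4 * output_prob ?w C (g a)" for a
  have G: "1 / 4 \<le> G a" "G a \<le> 1" for a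
    using output_prob_bounds[OF W(1), of C "g a"] by (auto simp: G_def)
  define B where "B a = - ln 4 * output_prob ?q C (g a) - ?d * query_count ?q S (g a)" for a
  have B: "B a \<le> ln (G a)" for a
    using Query.IH[of "g a" "insert {u, v} X"] Query.prems by (auto simp: G_def B_def)
  have "- ln 4 * output_prob ?q C (Query u v g) - ?d * query_count ?q S (Query u v g) =
      ?q u v * B True + (1 - ?q u v) * B False - ?d * of_bool ({u, v} \<in> S)"
    by (simp add: B_def algebra_simps)
  also have "\<dots> \<le> ?q u v * ln (G True) + (1 - ?q u v) * ln (G False) - ?d * of_bool ({u, v} \<in> S)"
    using convex_comb_mono[OF w(1,2) B B] by simp
  also have "\<dots> \<le> ln (?w u v * G True + (1 - ?w u v) * G False)"
  proof (cases "r u v = r0 u v")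
    case True
    have "0 < G a" for a using G[of a] by linarith
    then have "?w u v * ln (G True) + (1 - ?w u v) * ln (G False) \<le>
        ln (?w u v * G True + (1 - ?w u v) * G False)"
      using w by (intro ln_convex_comb_ge) auto
    moreover have "?q u v = ?w u v" using True by (simp add: answer_prob_def)
    moreover have "0 \<le> ?d * of_bool ({u, v} \<in> S)" by simp
    ultimately show ?thesis unfolding \<open>?q u v = ?w u v\<close> by linarith
  next
    case False
    then have S: "{u, v} \<in> S" using agree Query.prems by auto
    show ?thesis
      using False S ln_swapped_comb_ge[OF p G[of True] G[of False]]
        ln_swapped_comb_ge[OF p G[of False] G[of True]]
      by (cases "r u v") (auto simp: answer_prob_def add.commute)
  qed
  also have "?w u v * G True + (1 - ?w u v) * G False = 1 - 3 / 4 * output_prob ?w C (Query u v g)"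
    by (simp add: G_def field_simps)
  finally show ?case .
qed

lemma integrable_output_prob:
  assumes "unit_weights w"
  shows "integrable (measure_pmf A) (output_prob w C)"
  using output_prob_bounds[OF assms]
  by (intro measure_pmf.integrable_const_bound[where B = 1]) auto

lemma integrable_query_count:
  assumes "unit_weights w" "randomized_algorithm n A"
  shows "integrable (measure_pmf A) (query_count w S)"
proof (rule measure_pmf.integrable_const_bound[where B = "real (card (Pow {1..n}))"])
  show "AE t in measure_pmf A. norm (query_count w S t) \<le> real (card (Pow {1..n}))"
  proof (rule AE_pmfI)
    fix t assume "t \<in> set_pmf A"
    then show "norm (query_count w S t) \<le> real (card (Pow {1..n}))"
      using query_count_le_card[OF assms(1), of n "{}" t S] query_count_nonneg[OF assms(1), of S t]
        assms(2) by (simp add: randomized_algorithm_def)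
  qed
qed simp

text \<open>Summed over \<open>J\<close>, the null side of \<open>change_of_measure\<close> costs at
  most \<open>ln 4\<close> for the exclusive outputs and \<open>8 * (1 - 2 * p)\<^sup>2 * b\<close>
  for the queries, whatever the size of \<open>J\<close>.\<close>

lemma sum_output_prob_cut_off_le:
  fixes P S :: "'i \<Rightarrow> nat set set"
  assumes p: "0 \<le> p" "p < 1 / 2" and t: "admissible n {} t"
    and J: "finite J" "2 \<le> card J" "inj_on P J" "disjoint_family_on S J"
    and agree: "\<And>j u v. \<lbrakk>j \<in> J; u \<in> {1..n}; v \<in> {1..n}; u \<noteq> v; {u, v} \<notin> S j\<rbrakk> \<Longrightarrow>
      same_cluster (P j) u v = r0 u v"
  shows "(\<Sum>j\<in>J. output_prob (answer_prob p (same_cluster (P j))) (P j) (cut_off (\<Union>j\<in>J. S j) b t))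
    \<le> 0.7 * real (card J) + 5 * (1 - 2 * p)\<^sup>2 * real b"
proof -
  let ?m = "real (card J)" and ?d = "(1 - 2 * p)\<^sup>2" and ?q = "answer_prob p r0"
  define t' where "t' = cut_off (\<Union>j\<in>J. S j) b t"
  define y where "y j = output_prob (answer_prob p (same_cluster (P j))) (P j) t'" for j
  have W: "unit_weights (answer_prob p r)" for r using p unit_weights_answer_prob by auto
  have t': "admissible n {} t'" unfolding t'_def by (rule admissible_cut_off[OF t])
  have y: "- ln 4 * output_prob ?q (P j) t' - 8 * ?d * query_count ?q (S j) t'
      \<le> 3 / 2 - 15 / 8 * y j + ln (2 / 5)" if "j \<in> J" for j
  proof -
    have "0 < 1 - 3 / 4 * y j" 
      using output_prob_bounds(2)[OF W, of "same_cluster (P j)" "P j" t'] unfolding y_def by linarith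
    \<comment> \<open>The tangent of \<open>ln\<close> at \<open>2 / 5\<close>, the value of
      \<open>1 - 3 / 4 * y j\<close> when \<open>y j = 4 / 5\<close>, makes the bound linear in
      \<open>y j\<close>.\<close>
    then have "ln (1 - 3 / 4 * y j) \<le> (1 - 3 / 4 * y j) / (2 / 5) - 1 + ln (2 / 5)"
      using ln_le_minus_one[of "(1 - 3 / 4 * y j) / (2 / 5)"] by (simp only: ln_div) auto
    moreover have "- ln 4 * output_prob ?q (P j) t' - 8 * ?d * query_count ?q (S j) t'
        \<le> ln (1 - 3 / 4 * y j)"
      unfolding y_def using p t' agree[OF that] by (rule change_of_measure)
    ultimately show ?thesis by argo
  qed
  have "- ln 4 * 1 - 8 * ?d * real b \<le>
      - ln 4 * (\<Sum>j\<in>J. output_prob ?q (P j) t') - 8 * ?d * (\<Sum>j\<in>J. query_count ?q (S j) t')"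
    using sum_output_prob_le_1[OF W J(1,3), of r0 t'] query_count_cut_off_le[OF W, of r0 _ b t]
    unfolding sum_query_count_disjoint[OF J(1,4)] t'_def
    by (intro diff_mono mult_left_mono mult_left_mono_neg) auto
  also have "\<dots> = (\<Sum>j\<in>J. - ln 4 * output_prob ?q (P j) t' - 8 * ?d * query_count ?q (S j) t')"
    by (simp add: sum_subtractf sum_distrib_left sum_negf)
  also have "\<dots> \<le> (\<Sum>j\<in>J. 3 / 2 - 15 / 8 * y j + ln (2 / 5))"
    by (intro sum_mono y)
  also have "\<dots> = ?m * (3 / 2 + ln (2 / 5)) - 15 / 8 * sum y J"
    by (simp only: sum_subtractf sum.distrib sum_distrib_left[symmetric] sum_constant) argo
  finally have "15 / 8 * sum y J \<le> ?m * (3 / 2 + ln (2 / 5)) + ln 4 + 8 * ?d * real b" by simp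
  \<comment> \<open>\<open>ln 4 = 2 * ln 2\<close> is spread over at least two alternatives. With
    \<open>ln (4 / 5) \<le> - 1 / 5\<close> the coefficient of \<open>?m\<close> is at most 13/10;
    multiplying by 8/15 leaves at most 0.7 and 5.\<close>
  moreover have "ln (4::real) \<le> ?m * ln 2"
    using J(2) mult_right_mono[of 2 ?m "ln 2"] ln_mult[of 2 "2::real"] by simp
  moreover have "?m * (3 / 2 + ln (2 / 5)) + ?m * ln 2 \<le> ?m * (13 / 10)"
    unfolding distrib_left[symmetric]
    using ln_le_minus_one[of "4 / 5 :: real"] ln_mult[of 2 "2 / 5 :: real"]
    by (intro mult_left_mono) auto
  moreover have "0 \<le> ?d * real b" by simp
  ultimately have "sum y J \<le> 0.7 * ?m + 5 * (?d * real b)" by linarith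
  then show ?thesis by (simp add: y_def t'_def mult.assoc)
qed

lemma search_lower_bound:
  fixes P S :: "'i \<Rightarrow> nat set set"
  assumes p: "0 \<le> p" "p < 1 / 2" and A: "randomized_algorithm n A"
    and J: "finite J" "2 \<le> card J" "inj_on P J" "disjoint_family_on S J"
    and agree: "\<And>j u v. \<lbrakk>j \<in> J; u \<in> {1..n}; v \<in> {1..n}; u \<noteq> v; {u, v} \<notin> S j\<rbrakk> \<Longrightarrow>
      same_cluster (P j) u v = r0 u v"
    and succ: "\<And>j. j \<in> J \<Longrightarrow> 0.9 \<le> success_prob p (P j) A"
  shows "(real (card J))\<^sup>2 / (500 * (1 - 2 * p)\<^sup>2) \<le>
    (\<Sum>j\<in>J. measure_pmf.expectation A
       (query_count (answer_prob p (same_cluster (P j))) (\<Union>j\<in>J. S j)))"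
proof -
  let ?m = "real (card J)" and ?U = "\<Union>j\<in>J. S j" and ?w = "\<lambda>j. answer_prob p (same_cluster (P j))"
  define d where "d = (1 - 2 * p)\<^sup>2"
  have d: "0 < d" using p by (simp add: d_def)
  \<comment> \<open>This budget keeps \<open>5 * d * b\<close> below \<open>0.1 * ?m\<close>, so of
    the gap between 0.9 and 0.7 at least 0.1 per alternative is left for Markov's inequality.
    Rounding down is harmless because the latter has the factor \<open>b + 1\<close>.\<close>
  define b where "b = nat \<lfloor>?m / (50 * d)\<rfloor>"
  have "0 \<le> ?m / (50 * d)" using d by simp
  then have b: "real b \<le> ?m / (50 * d)" "?m / (50 * d) \<le> real b + 1" unfolding b_def by linarith+
  have W: "unit_weights (answer_prob p r)" for r using p unit_weights_answer_prob by auto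
  note int_o [simp] = integrable_output_prob[OF W] and int_q [simp] = integrable_query_count[OF W A]
  define X where "X = (\<Sum>j\<in>J. measure_pmf.expectation A (query_count (?w j) ?U))"
  have pointwise: "(\<Sum>j\<in>J. output_prob (?w j) (P j) t) \<le>
     (0.7 * ?m + 5 * d * real b) + (\<Sum>j\<in>J. query_count (?w j) ?U t) / (real b + 1)"
    if "t \<in> set_pmf A" for t
  proof -
    have t: "admissible n {} t" using A that by (simp add: randomized_algorithm_def)
    have "output_prob (?w j) (P j) t \<le> output_prob (?w j) (P j) (cut_off ?U b t) +
        query_count (?w j) ?U t / (real b + 1)" for j
      using output_prob_cut_off[OF W, of b "same_cluster (P j)" "P j" t ?U]
      by (simp add: field_simps)
    then have "(\<Sum>j\<in>J. output_prob (?w j) (P j) t) \<le>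
        (\<Sum>j\<in>J. output_prob (?w j) (P j) (cut_off ?U b t)) +
        (\<Sum>j\<in>J. query_count (?w j) ?U t) / (real b + 1)"
      by (simp add: sum_divide_distrib sum.distrib[symmetric] sum_mono)
    also have "(\<Sum>j\<in>J. output_prob (?w j) (P j) (cut_off ?U b t)) \<le> 0.7 * ?m + 5 * d * real b"
      unfolding d_def using p t J agree by (rule sum_output_prob_cut_off_le)
    finally show ?thesis by simp
  qed
  have "0.9 * ?m \<le> (\<Sum>j\<in>J. success_prob p (P j) A)"
    using sum_mono[of J "\<lambda>_. 0.9" "\<lambda>j. success_prob p (P j) A"] succ by simp
  also have "\<dots> = measure_pmf.expectation A (\<lambda>t. \<Sum>j\<in>J. output_prob (?w j) (P j) t)"
    using p by (simp add: success_prob_eq_expectation)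
  also have "\<dots> \<le> measure_pmf.expectation A
     (\<lambda>t. (0.7 * ?m + 5 * d * real b) + (\<Sum>j\<in>J. query_count (?w j) ?U t) / (real b + 1))"
    using pointwise by (intro integral_mono_AE AE_pmfI) auto
  also have "\<dots> = 0.7 * ?m + 5 * d * real b + X / (real b + 1)"
    by (simp add: X_def)
  also have "5 * d * real b \<le> 0.1 * ?m"
    using b(1) d by (simp add: field_simps)
  finally have "0.1 * ?m \<le> X / (real b + 1)" by simp
  then have "0.1 * ?m * (real b + 1) \<le> X" by (simp add: field_simps)
  moreover have "0.1 * ?m * (?m / (50 * d)) \<le> 0.1 * ?m * (real b + 1)"
    using b(2) by (intro mult_left_mono) auto
  moreover have "0.1 * ?m * (?m / (50 * d)) = ?m\<^sup>2 / (500 * d)"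
    using d by (simp add: power2_eq_square)
  ultimately show ?thesis unfolding X_def d_def by linarith
qed

subsection \<open>Clusterings as fibers of labellings\<close>

text \<open>Labellings make moving a vertex a function update. Different labellings may give the
  same clustering; injectivity is proved where the search bound needs it.\<close>

definition fibers :: "nat \<Rightarrow> (nat \<Rightarrow> nat) \<Rightarrow> nat set set" where
  "fibers n f = (\<lambda>y. {x \<in> {1..n}. f x = y}) ` f ` {1..n}"

definition fiber_size :: "nat \<Rightarrow> (nat \<Rightarrow> nat) \<Rightarrow> nat \<Rightarrow> nat" where
  "fiber_size n f y = card {x \<in> {1..n}. f x = y}"

lemma same_cluster_fibers:
  "u \<in> {1..n} \<Longrightarrow> v \<in> {1..n} \<Longrightarrow> same_cluster (fibers n f) u v \<longleftrightarrow> f u = f v"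
  unfolding same_cluster_def fibers_def by auto

lemma fibers_in_clusterings:
  assumes "card (f ` {1..n}) = k"
  shows "fibers n f \<in> clusterings n k"
proof -
  have "partition_on {1..n} (fibers n f)"
    by (rule partition_onI) (auto simp: fibers_def disjnt_def)
  moreover have "inj_on (\<lambda>y. {x \<in> {1..n}. f x = y}) (f ` {1..n})"
    unfolding inj_on_def by blast
  then have "card (fibers n f) = k"
    unfolding fibers_def using assms by (simp add: card_image)
  ultimately show ?thesis by (simp add: clusterings_def)
qed

lemma card_image_fibers: "card ` fibers n f = fiber_size n f ` f ` {1..n}"
  by (simp add: fibers_def fiber_size_def image_image)

lemma fibers_in_max_bounded:
  assumes "card (f ` {1..n}) = k" "1 \<le> n"
    and "\<And>y. y \<in> f ` {1..n} \<Longrightarrow> real (fiber_size n f y) \<le> 4 * real n / real k"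
  shows "fibers n f \<in> max_bounded_clusterings n k"
proof -
  have "Max (fiber_size n f ` f ` {1..n}) \<in> fiber_size n f ` f ` {1..n}"
    using assms(2) by (intro Max_in) auto
  then obtain y where "y \<in> f ` {1..n}" "Max (fiber_size n f ` f ` {1..n}) = fiber_size n f y"
    by (rule imageE)
  then show ?thesis
    using assms(3)[of y] fibers_in_clusterings[OF assms(1)]
    by (simp only: max_bounded_clusterings_def card_image_fibers mem_Collect_eq simp_thms)
qed

lemma fibers_in_min_bounded:
  assumes "card (f ` {1..n}) = k" "1 \<le> n"
    and "\<And>y. y \<in> f ` {1..n} \<Longrightarrow> real n / (20 * real k) \<le> real (fiber_size n f y)"
  shows "fibers n f \<in> min_bounded_clusterings n k"
proof -
  have "Min (fiber_size n f ` f ` {1..n}) \<in> fiber_size n f ` f ` {1..n}"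
    using assms(2) by (intro Min_in) auto
  then obtain y where "y \<in> f ` {1..n}" "Min (fiber_size n f ` f ` {1..n}) = fiber_size n f y"
    by (rule imageE)
  then show ?thesis
    using assms(3)[of y] fibers_in_clusterings[OF assms(1)]
    by (simp only: min_bounded_clusterings_def card_image_fibers mem_Collect_eq simp_thms)
qed

lemma fiber_size_pos: "y \<in> f ` {1..n} \<Longrightarrow> 1 \<le> fiber_size n f y"
  by (auto simp: fiber_size_def Suc_le_eq card_gt_0_iff)

lemma sum_fiber_size:
  assumes "f ` {1..n} \<subseteq> Y" "finite Y"
  shows "(\<Sum>y\<in>Y. fiber_size n f y) = n"
  using sum.group[OF _ assms(2,1), of "\<lambda>_. 1::nat"] by (simp add: fiber_size_def)

lemma expectation_query_count_mono:
  assumes "0 \<le> p" "p < 1 / 2" "randomized_algorithm n A" "S \<subseteq> S'"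
  shows "measure_pmf.expectation A (query_count (answer_prob p r) S) \<le>
    measure_pmf.expectation A (query_count (answer_prob p r) S')"
proof -
  have W: "unit_weights (answer_prob p r)" using assms by (intro unit_weights_answer_prob) auto
  show ?thesis
    by (intro integral_mono integrable_query_count[OF W assms(3)] query_count_mono[OF W assms(4)])
qed

subsection \<open>A hidden pair\<close>

text \<open>When \<open>n\<close> is close to \<open>k\<close>, too few vertices can leave their
  cluster without emptying it. Instead, the null labelling \<open>h\<close> has \<open>k + 1\<close>
  clusters, among them the singletons of \<open>{1..L}\<close>; each alternative merges two of these
  singletons and so differs from \<open>h\<close> on a single pair.\<close>

lemma many_clusters_lower_bound:
  assumes p: "0 \<le> p" "p < 1 / 2" and k: "2 \<le> k" "k < n" "4 * n < 5 * k"
    and A: "randomized_algorithm n A"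
    and CC: "\<C> = max_bounded_clusterings n k \<or> \<C> = min_bounded_clusterings n k"
    and succ: "\<And>P. P \<in> \<C> \<Longrightarrow> 0.9 \<le> success_prob p P A"
  shows "\<exists>P\<in>\<C>. real n * real k / (10000 * (1 - 2 * p)\<^sup>2) \<le> expected_queries p P A"
proof -
  \<comment> \<open>Vertices beyond \<open>k + 1\<close> are folded one-to-one onto the labels
    \<open>L + 1\<close> to \<open>k + 1\<close>, so \<open>1\<close> to \<open>L\<close> remain
    alone. The assumption \<open>4 * n < 5 * k\<close> makes \<open>L\<close> exceed
    \<open>3 * k / 4\<close>.\<close>
  define L where "L = 2 * k + 2 - n"
  define h where "h x = (if x \<le> k + 1 then x else x - (n - k - 1))" for x
  define f where "f B x = (if x \<in> B then Min B else h x)" for B x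
  define J where "J = {B. B \<subseteq> {1..L} \<and> card B = 2}"
  have L: "3 \<le> L" "L \<le> k + 1" "3 * k + 4 \<le> 4 * L" "L + n = 2 * k + 2" using k by (auto simp: L_def)
  have h_inj: "u = v" if "h u = h v" "u \<le> L" "v \<le> n" for u v
    using that k L by (auto simp: h_def split: if_splits)
  have h_range: "h x \<in> {1..k + 1}" if "x \<in> {1..n}" for x
    using that k by (auto simp: h_def)
  have J_elim: "\<exists>i j. B = {i, j} \<and> i < j \<and> 1 \<le> i \<and> j \<le> L \<and> Min B = i" if "B \<in> J" for B
  proof -
    from that obtain x y where "B = {x, y}" "x \<noteq> y" "B \<subseteq> {1..L}"
      by (auto simp: J_def card_2_iff)
    then show ?thesis by (cases "x < y") (force simp: min_def)+
  qed
  have image: "card (f B ` {1..n}) = k" if B: "B \<in> J" for B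
  proof -
    obtain i j where ij: "B = {i, j}" "i < j" "1 \<le> i" "j \<le> L" "Min B = i" using J_elim[OF B] by blast
    \<comment> \<open>Merging frees exactly the label \<open>j\<close>, the larger element of
      \<open>B\<close>.\<close>
    have "f B ` {1..n} = {1..k + 1} - {j}"
    proof (intro equalityI subsetI)
      fix y assume "y \<in> f B ` {1..n}"
      then obtain x where x: "x \<in> {1..n}" "y = f B x" by auto
      have "h x \<noteq> j" if "x \<noteq> j"
        using h_inj[of j x] that ij x L by (auto simp: h_def)
      then show "y \<in> {1..k + 1} - {j}"
        using x h_range[of x] ij L by (auto simp: f_def)
    next
      fix y assume "y \<in> {1..k + 1} - {j}"
      then have "f B y = y" "y \<in> {1..n}" using ij k by (auto simp: f_def h_def)
      then show "y \<in> f B ` {1..n}" by force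
    qed
    then show ?thesis using ij L by simp
  qed
  have size: "fiber_size n (f B) y \<le> 2" if B: "B \<in> J" for B y
  proof -
    obtain i j where ij: "B = {i, j}" "i < j" "1 \<le> i" "j \<le> L" "Min B = i" using J_elim[OF B] by blast
    have "{x \<in> {1..n}. f B x = y} \<subseteq> (if y = i then {i, j} else {y, y + (n - k - 1)})"
    proof
      fix x assume x: "x \<in> {x \<in> {1..n}. f B x = y}"
      show "x \<in> (if y = i then {i, j} else {y, y + (n - k - 1)})"
      proof (cases "x \<in> B")
        case False
        then have "h x = y" using x by (simp add: f_def)
        moreover have "y \<noteq> i" using h_inj[of i x] ij x L False \<open>h x = y\<close> by (auto simp: h_def)
        ultimately show ?thesis using x k by (auto simp: h_def split: if_splits)
      qed (use x ij in \<open>auto simp: f_def\<close>)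
    qed
    then have "fiber_size n (f B) y \<le> card (if y = i then {i, j} else {y, y + (n - k - 1)})"
      unfolding fiber_size_def by (intro card_mono) auto
    also have "\<dots> \<le> 2" by (auto simp: card_insert_if)
    finally show ?thesis .
  qed
  \<comment> \<open>Sizes 1 and 2 meet both bounds, since \<open>4 * n / k\<close> is at least 2 and
    \<open>n / (20 * k)\<close> at most 1. One construction serves both classes.\<close>
  have mem: "fibers n (f B) \<in> \<C>" if B: "B \<in> J" for B
  proof -
    have "real (fiber_size n (f B) y) \<le> 4 * real n / real k" for y
    proof -
      have "real (fiber_size n (f B) y) \<le> 2" using size[OF B, of y] by linarith
      also have "2 \<le> 4 * real n / real k" using k by (simp add: field_simps)
      finally show ?thesis .
    qed
    moreover have "real n / (20 * real k) \<le> real (fiber_size n (f B) y)" if "y \<in> f B ` {1..n}" for y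
    proof -
      have "real n / (20 * real k) \<le> 1" using k by (simp add: field_simps)
      also have "1 \<le> real (fiber_size n (f B) y)" using fiber_size_pos[OF that] by linarith
      finally show ?thesis .
    qed
    ultimately show ?thesis
      using CC k fibers_in_max_bounded[OF image[OF B]] fibers_in_min_bounded[OF image[OF B]] by auto
  qed
  have agree: "same_cluster (fibers n (f B)) u v = (h u = h v)"
    if uv: "B \<in> J" "u \<in> {1..n}" "v \<in> {1..n}" "u \<noteq> v" "{u, v} \<notin> {B}" for B u v
  proof -
    obtain i j where ij: "B = {i, j}" "i < j" "1 \<le> i" "j \<le> L" "Min B = i" using J_elim[OF uv(1)] by blast
    have *: "h i = i" "h j = j" using ij L by (auto simp: h_def)
    have out: "h x \<noteq> i" "h x \<noteq> j" if "x \<notin> B" "x \<in> {1..n}" for x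
      using h_inj[of i x] h_inj[of j x] * that ij by auto
    consider "u \<in> B" "v \<notin> B" | "u \<notin> B" "v \<in> B" | "u \<notin> B" "v \<notin> B"
      using uv ij by auto
    then show ?thesis
    proof cases
      case 1
      then show ?thesis
        using uv out[of v] ij * by (auto simp: same_cluster_fibers f_def)
    next
      case 2
      then show ?thesis
        using uv out[of u] ij * by (auto simp: same_cluster_fibers f_def)
    qed (use uv in \<open>simp add: same_cluster_fibers f_def\<close>)
  qed
  have inj: "inj_on (\<lambda>B. fibers n (f B)) J"
  proof (rule inj_onI, rule ccontr)
    fix B B' assume B: "B \<in> J" "B' \<in> J" "fibers n (f B) = fibers n (f B')" "B \<noteq> B'"
    obtain i j where ij: "B = {i, j}" "i < j" "1 \<le> i" "j \<le> L" "Min B = i" using J_elim[OF B(1)] by blast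
    have V: "i \<in> {1..n}" "j \<in> {1..n}" using ij L k by auto
    have "same_cluster (fibers n (f B)) i j" using V ij by (simp add: same_cluster_fibers f_def)
    moreover have "\<not> same_cluster (fibers n (f B')) i j"
      using agree[of B' i j] B V ij L by (auto simp: h_def)
    ultimately show False using B by simp
  qed
  have "finite J" unfolding J_def by (rule finite_subset[of _ "Pow {1..L}"]) auto
  have "card J = L choose 2" unfolding J_def by (subst n_subsets) auto
  moreover have "even (L * (L - 1))" by (cases L) auto
  ultimately have cJ: "2 * card J = L * (L - 1)" by (simp add: choose_two)
  have "3 * 2 \<le> L * (L - 1)" using L by (intro mult_mono) auto
  then have m2: "2 \<le> card J" using cJ by linarith
  let ?m = "real (card J)" and ?E = "\<lambda>B. expected_queries p (fibers n (f B)) A"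
  let ?X = "real n * real k / (10000 * (1 - 2 * p)\<^sup>2)"
  \<comment> \<open>\<open>2 * card J = L * (L - 1)\<close> and
    \<open>3 * k \<le> 4 * (L - 1)\<close> give \<open>9 * k\<^sup>2 \<le> 32 * ?m\<close>. The
    factor 20 is generous; it is chosen so that \<open>20 * 500 = 10000\<close>.\<close>
  have nk: "real n * real k \<le> 20 * ?m"
  proof -
    have "real (3 * k) * real (3 * k) \<le> real (4 * L) * real (4 * (L - 1))"
      using L by (intro mult_mono) (auto simp del: of_nat_mult)
    also have "\<dots> = 32 * ?m" using arg_cong[OF cJ, of real] by simp
    finally have "9 * (real k * real k) \<le> 32 * ?m" by simp
    moreover have "real (4 * n) * real k \<le> real (5 * k) * real k"
      using k by (intro mult_right_mono) (auto simp del: of_nat_mult)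
    then have "4 * (real n * real k) \<le> 5 * (real k * real k)" by simp
    moreover have "0 \<le> ?m" by simp
    ultimately show ?thesis by linarith
  qed
  have d: "0 < (1 - 2 * p)\<^sup>2" using p by simp
  have "?m * ?X \<le> ?m * (?m / (500 * (1 - 2 * p)\<^sup>2))"
    using nk d by (intro mult_left_mono) (auto simp: field_simps)
  also have "\<dots> = ?m\<^sup>2 / (500 * (1 - 2 * p)\<^sup>2)" by (simp add: power2_eq_square)
  also have "\<dots> \<le> (\<Sum>B\<in>J. measure_pmf.expectation A
       (query_count (answer_prob p (same_cluster (fibers n (f B)))) (\<Union>B\<in>J. {B})))"
  proof (rule search_lower_bound[OF p A \<open>finite J\<close> m2 inj])
    show "disjoint_family_on (\<lambda>B. {B}) J" by (auto simp: disjoint_family_on_def)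
  qed (fact agree, use succ mem in blast)
  also have "\<dots> \<le> sum ?E J"
    using p by (intro sum_mono) (simp add: expected_queries_eq_expectation
      expectation_query_count_mono[OF p A])
  finally have sum: "?m * ?X \<le> sum ?E J" .
  have "\<exists>B\<in>J. ?X \<le> ?E B"
  proof (rule ccontr)
    assume "\<not> ?thesis"
    then have "sum ?E J < (\<Sum>B\<in>J. ?X)"
      using m2 \<open>finite J\<close> by (intro sum_strict_mono) auto
    then show False using sum by simp
  qed
  then show ?thesis using mem by blast
qed

subsection \<open>Moving a single vertex\<close>

text \<open>Handshake argument: every query of an admissible tree has two distinct endpoints in
  \<open>{1..n}\<close>.\<close>

lemma sum_query_count_vertices:
  assumes "admissible n X t"
  shows "(\<Sum>v\<in>{1..n}. query_count w {e. v \<in> e} t) = 2 * query_count w UNIV t"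
  using assms
proof (induction t arbitrary: X)
  case (Query u v g)
  have "(\<Sum>x\<in>{1..n}. of_bool (x \<in> {u, v})) = real (card ({1..n} \<inter> {u, v}))"
    by (simp add: of_bool_def sum.If_cases Int_def)
  also have "{1..n} \<inter> {u, v} = {u, v}" using Query.prems by auto
  finally have "(\<Sum>x\<in>{1..n}. of_bool (x \<in> {u, v})) = (2::real)" using Query.prems by simp
  moreover have "(\<Sum>x\<in>{1..n}. query_count w {e. x \<in> e} (g a)) = 2 * query_count w UNIV (g a)" for a
    using Query.IH[OF rangeI] Query.prems unfolding admissible.simps by blast
  ultimately show ?case
    by (simp only: query_count.simps sum.distrib sum_distrib_left[symmetric] mem_Collect_eq
        UNIV_I of_bool_eq) argo
qed simp

text \<open>Labellings that agree off \<open>v\<close> form a class \<open>J\<close> to which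
  \<open>search_lower_bound\<close> applies; its bound, quadratic in \<open>card J\<close>, amounts
  to a charge of \<open>card J\<close> for each member. The label 0 is a placeholder erasing the
  label of \<open>v\<close>. One-element classes offer no alternative and get weight 0.\<close>

lemma vertex_moves_lower_bound:
  fixes F :: "(nat \<Rightarrow> nat) set"
  defines "moves v f \<equiv> {g \<in> F. g(v := 0) = f(v := 0)}"
  assumes p: "0 \<le> p" "p < 1 / 2" and A: "randomized_algorithm n A"
    and F: "finite F" "\<And>f. f \<in> F \<Longrightarrow> f ` {1..n} = {1..k}"
    and succ: "\<And>f. f \<in> F \<Longrightarrow> 0.9 \<le> success_prob p (fibers n f) A"
    and v: "v \<in> {1..n}"
  shows "(\<Sum>f\<in>F. if 2 \<le> card (moves v f) then real (card (moves v f)) else 0) / (500 * (1 - 2 * p)\<^sup>2) \<le>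
    (\<Sum>f\<in>F. measure_pmf.expectation A
      (query_count (answer_prob p (same_cluster (fibers n f))) {e. v \<in> e}))"
proof -
  let ?c = "500 * (1 - 2 * p)\<^sup>2"
  let ?E = "\<lambda>f. measure_pmf.expectation A
      (query_count (answer_prob p (same_cluster (fibers n f))) {e. v \<in> e})"
  define \<phi> where "\<phi> m = (if 2 \<le> m then real m else 0)" for m :: nat
  have W: "unit_weights (answer_prob p r)" for r using p unit_weights_answer_prob by auto
  have E_nonneg: "0 \<le> ?E f" for f using query_count_nonneg[OF W] by simp
  have fiber: "(\<Sum>f\<in>J. \<phi> (card (moves v f)) / ?c) \<le> sum ?E J"
    if J: "J = {f \<in> F. f(v := 0) = h}" for h J
  proof -
    have "moves v f = J" if "f \<in> J" for f using that by (auto simp: moves_def J)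
    then have eq: "(\<Sum>f\<in>J. \<phi> (card (moves v f)) / ?c) = real (card J) * \<phi> (card J) / ?c" by simp
    show ?thesis
    proof (cases "2 \<le> card J")
      case False
      then show ?thesis unfolding eq using E_nonneg by (simp add: \<phi>_def sum_nonneg)
    next
      case True
      have JF: "f \<in> F" "\<And>x. x \<noteq> v \<Longrightarrow> f x = h x" if "f \<in> J" for f
        using that by (auto simp: J)
      have Jv: "f v \<noteq> g v" if "f \<in> J" "g \<in> J" "f \<noteq> g" for f g
      proof
        assume "f v = g v"
        then have "f x = g x" for x using JF(2)[of f x] JF(2)[of g x] that by (cases "x = v") auto
        then show False using that by auto
      qed
      \<comment> \<open>Compared with a null pattern isolating \<open>v\<close>, \<open>f\<close>
        differs exactly on the pairs joining \<open>v\<close> to its cluster. Members of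
        \<open>J\<close> give \<open>v\<close> distinct labels and agree elsewhere, so these sets
        are disjoint.\<close>
      define S where "S f = {{v, u} |u. u \<in> {1..n} - {v} \<and> f u = f v}" for f :: "nat \<Rightarrow> nat"
      have disj: "disjoint_family_on S J"
      proof (unfold disjoint_family_on_def, intro ballI impI equals0I)
        fix f g e assume fg: "f \<in> J" "g \<in> J" "f \<noteq> g" and "e \<in> S f \<inter> S g"
        then obtain u where "u \<noteq> v" "f u = f v" "g u = g v"
          unfolding S_def by (auto simp: doubleton_eq_iff)
        then show False using Jv[OF fg] JF(2)[of f u] JF(2)[of g u] fg by simp
      qed
      have inj: "inj_on (fibers n) J"
      proof (rule inj_onI, rule ccontr)
        fix f g assume fg: "f \<in> J" "g \<in> J" "fibers n f = fibers n g" "f \<noteq> g"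
        \<comment> \<open>All labels are used, so the label \<open>g v\<close> has under
          \<open>f\<close> a holder \<open>u\<close> other than \<open>v\<close>; then
          \<open>u\<close> and \<open>v\<close> are together under \<open>g\<close> but not under
          \<open>f\<close>.\<close>
        have "g v \<in> f ` {1..n}" 
          using F(2)[OF JF(1)[OF fg(1)]] F(2)[OF JF(1)[OF fg(2)]] v by blast
        then obtain u where u: "u \<in> {1..n}" "f u = g v" by auto
        have "f v \<noteq> g v" using Jv fg by blast
        with u have "u \<noteq> v" by auto
        then have "f u = g u" using JF(2)[of f u] JF(2)[of g u] fg by simp
        then show False
          using same_cluster_fibers[OF u(1) v, of f] same_cluster_fibers[OF u(1) v, of g] fg(3)
            u(2) \<open>f v \<noteq> g v\<close> by simp
      qed
      have agree: "same_cluster (fibers n f) x y = (x \<noteq> v \<and> y \<noteq> v \<and> h x = h y)"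
        if "f \<in> J" "x \<in> {1..n}" "y \<in> {1..n}" "x \<noteq> y" "{x, y} \<notin> S f" for f x y
      proof -
        have "f x \<noteq> f y" if "x = v \<or> y = v"
          using \<open>{x, y} \<notin> S f\<close> \<open>x \<in> _\<close> \<open>y \<in> _\<close> \<open>x \<noteq> y\<close> that
          unfolding S_def by (auto simp: insert_commute)
        moreover have "f x = h x \<and> f y = h y" if "\<not> (x = v \<or> y = v)"
          using that JF(2)[OF \<open>f \<in> J\<close>] by simp
        ultimately show ?thesis
          unfolding same_cluster_fibers[OF \<open>x \<in> _\<close> \<open>y \<in> _\<close>] by metis
      qed
      have "(real (card J))\<^sup>2 / ?c \<le> (\<Sum>f\<in>J. measure_pmf.expectation A
          (query_count (answer_prob p (same_cluster (fibers n f))) (\<Union>f\<in>J. S f)))"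
      proof (rule search_lower_bound[OF p A _ True inj disj])
        show "finite J" using F(1) by (simp add: J)
      qed (fact agree, use succ JF(1) in blast)
      also have "\<dots> \<le> sum ?E J"
        by (intro sum_mono expectation_query_count_mono[OF p A]) (auto simp: S_def)
      finally show ?thesis unfolding eq using True by (simp add: \<phi>_def power2_eq_square)
    qed
  qed
  have "(\<Sum>f\<in>F. \<phi> (card (moves v f)) / ?c) =
      (\<Sum>h\<in>(\<lambda>f. f(v := 0)) ` F. \<Sum>f\<in>{f \<in> F. f(v := 0) = h}. \<phi> (card (moves v f)) / ?c)"
    by (rule sum.image_gen[OF F(1)])
  also have "\<dots> \<le> (\<Sum>h\<in>(\<lambda>f. f(v := 0)) ` F. \<Sum>f\<in>{f \<in> F. f(v := 0) = h}. ?E f)"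
    by (intro sum_mono fiber[OF refl])
  also have "\<dots> = sum ?E F" by (rule sum.image_gen[OF F(1), symmetric])
  finally show ?thesis by (simp add: \<phi>_def sum_divide_distrib)
qed

text \<open>Averages over \<open>F\<close> after summing over \<open>v\<close>. Each query is
  counted at both endpoints, which turns 500 into 1000.\<close>

lemma total_moves_lower_bound:
  fixes F :: "(nat \<Rightarrow> nat) set"
  defines "moves v f \<equiv> {g \<in> F. g(v := 0) = f(v := 0)}"
  assumes p: "0 \<le> p" "p < 1 / 2" and A: "randomized_algorithm n A"
    and F: "finite F" "F \<noteq> {}" "\<And>f. f \<in> F \<Longrightarrow> f ` {1..n} = {1..k}"
    and succ: "\<And>f. f \<in> F \<Longrightarrow> 0.9 \<le> success_prob p (fibers n f) A"
    and M: "\<And>f. f \<in> F \<Longrightarrow>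
      M \<le> (\<Sum>v\<in>{1..n}. if 2 \<le> card (moves v f) then real (card (moves v f)) else 0)"
  shows "\<exists>f\<in>F. M / (1000 * (1 - 2 * p)\<^sup>2) \<le> expected_queries p (fibers n f) A"
proof (rule ccontr)
  assume neg: "\<not> ?thesis"
  let ?d = "(1 - 2 * p)\<^sup>2" and ?w = "\<lambda>f. answer_prob p (same_cluster (fibers n f))"
  define \<phi> where "\<phi> v f = (if 2 \<le> card (moves v f) then real (card (moves v f)) else 0)" for v f
  have d: "0 < ?d" using p by simp
  have W: "unit_weights (answer_prob p r)" for r using p unit_weights_answer_prob by auto
  have double: "(\<Sum>v\<in>{1..n}. measure_pmf.expectation A (query_count (?w f) {e. v \<in> e})) =
      2 * expected_queries p (fibers n f) A" for f
  proof -
    have "(\<Sum>v\<in>{1..n}. measure_pmf.expectation A (query_count (?w f) {e. v \<in> e})) =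
      measure_pmf.expectation A (\<lambda>t. \<Sum>v\<in>{1..n}. query_count (?w f) {e. v \<in> e} t)"
      using integrable_query_count[OF W A] by simp
    also have "\<dots> = measure_pmf.expectation A (\<lambda>t. 2 * query_count (?w f) UNIV t)"
      using A sum_query_count_vertices
      by (intro integral_cong_AE AE_pmfI) (auto simp: randomized_algorithm_def)
    finally show ?thesis using p by (simp add: expected_queries_eq_expectation)
  qed
  have "real (card F) * (M / (500 * ?d)) \<le> (\<Sum>f\<in>F. (\<Sum>v\<in>{1..n}. \<phi> v f) / (500 * ?d))"
    using M d by (intro sum_bounded_below) (auto simp: \<phi>_def divide_right_mono)
  also have "\<dots> = (\<Sum>v\<in>{1..n}. (\<Sum>f\<in>F. \<phi> v f) / (500 * ?d))"
    by (simp only: sum_divide_distrib) (rule sum.swap)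
  also have "\<dots> \<le> (\<Sum>v\<in>{1..n}. \<Sum>f\<in>F. measure_pmf.expectation A (query_count (?w f) {e. v \<in> e}))"
    unfolding \<phi>_def moves_def
    using F(3) succ by (intro sum_mono vertex_moves_lower_bound[OF p A F(1)])
  also have "\<dots> = (\<Sum>f\<in>F. 2 * expected_queries p (fibers n f) A)"
    by (subst sum.swap) (simp only: double)
  also have "\<dots> < (\<Sum>f\<in>F. M / (500 * ?d))"
    using neg F(1,2) by (intro sum_strict_mono) (auto simp: not_le)
  finally show False by simp
qed

section \<open>Balanced labellings and their single-vertex moves\<close>

text \<open>The parameters \<open>a\<close> and \<open>b\<close> let one family serve both classes.
  Nonempty fibers keep the number of clusters equal to \<open>k\<close>, and extensionality makes
  the family finite.\<close>

definition bounded_labellings :: "nat \<Rightarrow> nat \<Rightarrow> real \<Rightarrow> real \<Rightarrow> (nat \<Rightarrow> nat) set" where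
  "bounded_labellings n k a b = {f \<in> {1..n} \<rightarrow>\<^sub>E {1..k}.
     \<forall>y\<in>{1..k}. 1 \<le> fiber_size n f y \<and> a \<le> real (fiber_size n f y) \<and> real (fiber_size n f y) \<le> b}"

lemma finite_bounded_labellings: "finite (bounded_labellings n k a b)"
  unfolding bounded_labellings_def by (rule finite_subset[OF _ finite_PiE[of "{1..n}" "\<lambda>_. {1..k}"]]) auto

lemma bounded_labellings_image:
  assumes "f \<in> bounded_labellings n k a b"
  shows "f ` {1..n} = {1..k}"
proof
  show "{1..k} \<subseteq> f ` {1..n}"
  proof
    fix y assume "y \<in> {1..k}"
    then have "fiber_size n f y \<noteq> 0" using assms by (force simp: bounded_labellings_def)
    then have "{x \<in> {1..n}. f x = y} \<noteq> {}" unfolding fiber_size_def by (metis card.empty)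
    then show "y \<in> f ` {1..n}" by auto
  qed
qed (use assms in \<open>auto simp: bounded_labellings_def\<close>)

lemma bounded_labellings_nonempty:
  assumes "1 \<le> k" "k \<le> n" "a \<le> real n / (20 * real k)" "4 * real n / real k \<le> b"
  shows "bounded_labellings n k a b \<noteq> {}"
proof -
  \<comment> \<open>Round-robin labelling, whose fibers have \<open>n div k\<close> elements or one
    more.\<close>
  define f where "f = restrict (\<lambda>x. (x - 1) mod k + 1) {1..n}"
  let ?q = "n div k"
  have q: "1 \<le> ?q" using assms by (simp add: Suc_le_eq div_greater_zero_iff)
  have "n mod k < k" using assms by simp
  moreover have "n = ?q * k + n mod k" by simp
  moreover have "k \<le> ?q * k" using q by simp
  ultimately have "n \<le> 2 * (?q * k)" by linarith
  then have "real n \<le> real (2 * (?q * k))" by (rule of_nat_mono)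
  then have q1: "real n / (20 * real k) \<le> real ?q" using assms by (simp add: field_simps)
  have "real (?q * k) \<le> real n" by (intro of_nat_mono) simp
  moreover have "real k \<le> real n" using assms by simp
  ultimately have q2: "real ?q + 1 \<le> 4 * real n / real k"
    using assms by (simp add: field_simps)
  have nat_size: "?q \<le> fiber_size n f y \<and> fiber_size n f y \<le> ?q + 1" if y: "y \<in> {1..k}" for y
  proof
    let ?X = "{x \<in> {1..n}. f x = y}"
    have "(\<lambda>i. y + i * k) ` {..<?q} \<subseteq> ?X"
    proof clarify
      fix i assume "i < ?q"
      then have "(i + 1) * k \<le> ?q * k" by (intro mult_right_mono) auto
      also have "\<dots> \<le> n" by simp
      finally have "y + i * k \<le> n" using y by simp
      moreover have "(y + i * k - 1) mod k = y - 1"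
      proof -
        have "y + i * k - 1 = (y - 1) + i * k" using y by auto
        then show ?thesis using y by (simp only: mod_mult_self1) auto
      qed
      ultimately show "y + i * k \<in> {1..n} \<and> f (y + i * k) = y" using y by (simp add: f_def)
    qed
    moreover have "inj_on (\<lambda>i. y + i * k) {..<?q}" using assms by (auto simp: inj_on_def)
    ultimately have "card {..<?q} \<le> card ?X" by (intro card_inj_on_le) auto
    then show "?q \<le> fiber_size n f y" by (simp add: fiber_size_def)
    have "inj_on (\<lambda>x. (x - 1) div k) ?X"
    proof (rule inj_onI)
      fix x x' assume x: "x \<in> ?X" "x' \<in> ?X" "(x - 1) div k = (x' - 1) div k"
      then have "(x - 1) mod k = (x' - 1) mod k" by (auto simp: f_def)
      then have "x - 1 = x' - 1" using x(3) by (metis div_mult_mod_eq)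
      then show "x = x'" using x by auto
    qed
    moreover have "(\<lambda>x. (x - 1) div k) ` ?X \<subseteq> {..?q}" by (auto intro: div_le_mono)
    ultimately have "card ?X \<le> card {..?q}" by (intro card_inj_on_le) auto
    then show "fiber_size n f y \<le> ?q + 1" by (simp add: fiber_size_def)
  qed
  have size: "1 \<le> fiber_size n f y \<and> a \<le> real (fiber_size n f y) \<and> real (fiber_size n f y) \<le> b"
    if "y \<in> {1..k}" for y
  proof -
    have "real ?q \<le> real (fiber_size n f y)" "real (fiber_size n f y) \<le> real ?q + 1"
      using nat_size[OF that] by linarith+
    then show ?thesis using nat_size[OF that] q q1 q2 assms(3,4) by linarith
  qed
  have "f \<in> {1..n} \<rightarrow>\<^sub>E {1..k}"
    using assms by (auto simp: f_def Suc_le_eq)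
  then have "f \<in> bounded_labellings n k a b"
    unfolding bounded_labellings_def using size by blast
  then show ?thesis by auto
qed

lemma move_in_bounded_labellings:
  assumes f: "f \<in> bounded_labellings n k a b" and v: "v \<in> {1..n}"
    and removable: "2 \<le> fiber_size n f (f v)" "a + 1 \<le> real (fiber_size n f (f v))"
    and j: "j \<in> {1..k}" "real (fiber_size n f j) + 1 \<le> b"
  shows "f(v := j) \<in> bounded_labellings n k a b"
proof (cases "j = f v")
  case True
  then show ?thesis using f by simp
next
  case False
  let ?X = "\<lambda>y. {x \<in> {1..n}. f x = y}" and ?Y = "\<lambda>y. {x \<in> {1..n}. (f(v := j)) x = y}"
  have "?Y j = insert v (?X j)" "?Y (f v) = ?X (f v) - {v}" using v False by auto
  moreover have "?Y y = ?X y" if "y \<noteq> j" "y \<noteq> f v" for y using that by auto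
  ultimately have size: "fiber_size n (f(v := j)) y =
    (if y = j then fiber_size n f y + 1 else if y = f v then fiber_size n f y - 1 else fiber_size n f y)" for y
    using v False by (auto simp: fiber_size_def)
  have "f(v := j) \<in> {1..n} \<rightarrow>\<^sub>E {1..k}"
    using f v j by (auto simp: bounded_labellings_def PiE_iff extensional_def)
  moreover have "1 \<le> fiber_size n (f(v := j)) y \<and> a \<le> real (fiber_size n (f(v := j)) y) \<and>
      real (fiber_size n (f(v := j)) y) \<le> b" if "y \<in> {1..k}" for y
  proof -
    have "1 \<le> fiber_size n f y" "a \<le> real (fiber_size n f y)" "real (fiber_size n f y) \<le> b"
      using f that by (auto simp: bounded_labellings_def)
    then show ?thesis using removable j(2) by (auto simp: size of_nat_diff)
  qed
  ultimately show ?thesis unfolding bounded_labellings_def by blast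
qed

text \<open>A label that cannot take another vertex already holds more than
  \<open>4 * n / k - 1 \<ge> 3 * n / k\<close> vertices. Hence at most \<open>k / 3\<close> labels
  are full, and \<open>v\<close> can go to all others.\<close>

lemma card_moves_ge:
  assumes f: "f \<in> bounded_labellings n k a b" and v: "v \<in> {1..n}" and k: "1 \<le> k" "k \<le> n"
    and b: "4 * real n / real k \<le> b"
    and removable: "2 \<le> fiber_size n f (f v)" "a + 1 \<le> real (fiber_size n f (f v))"
  shows "2 / 3 * real k \<le> real (card {g \<in> bounded_labellings n k a b. g(v := 0) = f(v := 0)})"
proof -
  define full where "full = {j \<in> {1..k}. b < real (fiber_size n f j) + 1}"
  have "3 * real n / real k \<le> real (fiber_size n f j)" if "j \<in> full" for j
  proof -
    have "1 \<le> real n / real k" using k by simp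
    moreover have "4 * real n / real k = 3 * real n / real k + real n / real k"
      by (simp add: add_divide_distrib[symmetric])
    moreover have "b < real (fiber_size n f j) + 1" using that by (simp add: full_def)
    ultimately show ?thesis using b by linarith
  qed
  then have "real (card full) * (3 * real n / real k) \<le> (\<Sum>j\<in>full. real (fiber_size n f j))"
    by (intro sum_bounded_below) auto
  also have "\<dots> \<le> (\<Sum>j\<in>{1..k}. real (fiber_size n f j))"
    by (intro sum_mono2) (auto simp: full_def)
  also have "\<dots> = real n"
    using sum_fiber_size[of f n "{1..k}"] bounded_labellings_image[OF f] of_nat_sum by (metis finite_atLeastAtMost order_refl)
  finally have full: "3 * real (card full) \<le> real k" using k by (simp add: field_simps)
  have "card ({1..k} - full) \<le> card {g \<in> bounded_labellings n k a b. g(v := 0) = f(v := 0)}"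
  proof (rule card_inj_on_le)
    show "inj_on (\<lambda>j. f(v := j)) ({1..k} - full)" by (auto simp: inj_on_def dest: fun_upd_eqD)
    show "(\<lambda>j. f(v := j)) ` ({1..k} - full) \<subseteq> {g \<in> bounded_labellings n k a b. g(v := 0) = f(v := 0)}"
    proof clarify
      fix j assume "j \<in> {1..k}" "j \<notin> full"
      then have "real (fiber_size n f j) + 1 \<le> b" by (simp add: full_def not_less)
      then show "f(v := j) \<in> bounded_labellings n k a b \<and> (f(v := j))(v := 0) = f(v := 0)"
        using move_in_bounded_labellings[OF f v removable \<open>j \<in> {1..k}\<close>] by simp
    qed
  qed (simp add: finite_bounded_labellings)
  moreover have "card full \<le> card {1..k}" by (intro card_mono) (auto simp: full_def)
  then have "real (card ({1..k} - full)) = real k - real (card full)"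
    by (subst card_Diff_subset) (auto simp: full_def of_nat_diff)
  ultimately show ?thesis using full by linarith
qed

text \<open>Each label holds at most \<open>a + 1 \<le> n / (20 * k) + 1\<close> vertices that
  cannot leave, in total \<open>n / 20 + k \<le> 17 * n / 20\<close>, because
  \<open>k \<le> 4 * n / 5\<close>.\<close>

lemma card_removable_ge:
  assumes f: "f ` {1..n} \<subseteq> {1..k}" and k: "1 \<le> k" "5 * k \<le> 4 * n" and a: "0 \<le> a" "a \<le> real n / (20 * real k)"
  shows "3 / 20 * real n \<le> real (card {v \<in> {1..n}. 2 \<le> fiber_size n f (f v) \<and> a + 1 \<le> real (fiber_size n f (f v))})"
    (is "_ \<le> real (card ?G)")
proof -
  let ?B = "\<lambda>y. {v \<in> {1..n} - ?G. f v = y}"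
  have B: "real (card (?B y)) \<le> real n / (20 * real k) + 1" for y
  proof (cases "?B y = {}")
    case False
    then obtain v where "v \<in> ?B y" by blast
    then have "real (fiber_size n f y) \<le> a + 1" using a by auto
    moreover have "card (?B y) \<le> fiber_size n f y"
      unfolding fiber_size_def by (intro card_mono) auto
    ultimately show ?thesis using a by linarith
  qed (simp only: card.empty, simp)
  have "{1..n} - ?G \<subseteq> (\<Union>y\<in>{1..k}. ?B y)" using f by auto
  then have "card ({1..n} - ?G) \<le> card (\<Union>y\<in>{1..k}. ?B y)" by (intro card_mono) auto
  also have "\<dots> \<le> (\<Sum>y\<in>{1..k}. card (?B y))" by (rule card_UN_le) simp
  finally have "real (card ({1..n} - ?G)) \<le> (\<Sum>y\<in>{1..k}. real (card (?B y)))"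
    using of_nat_mono by fastforce
  also have "\<dots> \<le> real (card {1..k}) * (real n / (20 * real k) + 1)" using B by (rule sum_bounded_above)
  also have "\<dots> = real n / 20 + real k" using k by (simp add: field_simps)
  finally have "real (card ({1..n} - ?G)) \<le> real n / 20 + real k" .
  moreover have "card ({1..n} - ?G) = card {1..n} - card ?G" by (rule card_Diff_subset) auto
  then have "real (card ({1..n} - ?G)) \<ge> real n - real (card ?G)" by simp
  moreover have "5 * real k \<le> 4 * real n" using k(2) by linarith
  ultimately show ?thesis by linarith
qed

lemma few_clusters_lower_bound:
  assumes p: "0 \<le> p" "p < 1 / 2" and k: "2 \<le> k" "5 * k \<le> 4 * n"
    and A: "randomized_algorithm n A"
    and CC: "\<C> = max_bounded_clusterings n k \<or> \<C> = min_bounded_clusterings n k"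
    and succ: "\<And>P. P \<in> \<C> \<Longrightarrow> 0.9 \<le> success_prob p P A"
  shows "\<exists>P\<in>\<C>. real n * real k / (10000 * (1 - 2 * p)\<^sup>2) \<le> expected_queries p P A"
proof -
  have kn: "1 \<le> k" "k \<le> n" "1 \<le> n" using k by auto
  obtain a b where ab: "0 \<le> a" "a \<le> real n / (20 * real k)" "4 * real n / real k \<le> b"
    and mem: "\<And>f. f \<in> bounded_labellings n k a b \<Longrightarrow> fibers n f \<in> \<C>"
  proof (cases "\<C> = max_bounded_clusterings n k")
    case True
    show ?thesis
    proof (rule that[of 0 "4 * real n / real k"])
      fix f assume f: "f \<in> bounded_labellings n k 0 (4 * real n / real k)"
      then show "fibers n f \<in> \<C>"
        unfolding True using kn bounded_labellings_image[OF f]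
        by (intro fibers_in_max_bounded) (auto simp: bounded_labellings_def)
    qed auto
  next
    case False
    then have C: "\<C> = min_bounded_clusterings n k" using CC by simp
    show ?thesis
    \<comment> \<open>The upper bound \<open>4 * n / k\<close> is kept here too, so that
      \<open>card_moves_ge\<close> applies to both classes.\<close>
    proof (rule that[of "real n / (20 * real k)" "4 * real n / real k"])
      fix f assume f: "f \<in> bounded_labellings n k (real n / (20 * real k)) (4 * real n / real k)"
      then show "fibers n f \<in> \<C>"
        unfolding C using kn bounded_labellings_image[OF f]
        by (intro fibers_in_min_bounded) (auto simp: bounded_labellings_def)
    qed auto
  qed
  let ?F = "bounded_labellings n k a b"
  let ?m = "\<lambda>v f. card {g \<in> ?F. g(v := 0) = f(v := 0)}"
  have moves: "real n * real k / 10 \<le> (\<Sum>v\<in>{1..n}. if 2 \<le> ?m v f then real (?m v f) else 0)"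
    if f: "f \<in> ?F" for f
  proof -
    let ?G = "{v \<in> {1..n}. 2 \<le> fiber_size n f (f v) \<and> a + 1 \<le> real (fiber_size n f (f v))}"
    have G: "2 / 3 * real k \<le> real (?m v f)" "2 \<le> ?m v f" if "v \<in> ?G" for v
    proof -
      show *: "2 / 3 * real k \<le> real (?m v f)"
        using that kn ab by (intro card_moves_ge[OF f]) auto
      \<comment> \<open>\<open>2 / 3 * k\<close> exceeds 1 and the cardinality is an integer, so the
        class of \<open>f\<close> is not of weight 0.\<close>
      have "real k \<ge> 2" using k by simp
      with * have "real 1 < real (?m v f)" by linarith
      then show "2 \<le> ?m v f" by linarith
    qed
    have "3 / 20 * real n \<le> real (card ?G)"
      using bounded_labellings_image[OF f] kn k ab by (intro card_removable_ge) auto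
    \<comment> \<open>The product \<open>3 / 20 * (2 / 3) = 1 / 10\<close>, divided by 1000, gives
      the constant 1/10000.\<close>
    then have "3 / 20 * real n * (2 / 3 * real k) \<le> real (card ?G) * (2 / 3 * real k)"
      by (intro mult_right_mono) auto
    also have "\<dots> \<le> (\<Sum>v\<in>?G. if 2 \<le> ?m v f then real (?m v f) else 0)"
      by (intro sum_bounded_below) (use G in auto)
    also have "\<dots> \<le> (\<Sum>v\<in>{1..n}. if 2 \<le> ?m v f then real (?m v f) else 0)"
      by (intro sum_mono2) auto
    finally show ?thesis by (simp add: mult.commute)
  qed
  have "\<exists>f\<in>?F. (real n * real k / 10) / (1000 * (1 - 2 * p)\<^sup>2) \<le> expected_queries p (fibers n f) A"
  proof (rule total_moves_lower_bound[OF p A finite_bounded_labellings])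
    show "?F \<noteq> {}" by (rule bounded_labellings_nonempty[OF kn(1,2) ab(2,3)])
  qed (fact bounded_labellings_image, use succ mem in blast, fact moves)
  then show ?thesis using mem by auto
qed

section \<open>Divergence and the combined bound\<close>

text \<open>Applies \<open>ln x \<le> x - 1\<close> to the odds \<open>p / (1 - p)\<close>. In this
  direction the divergence may replace \<open>(1 - 2 * p)\<^sup>2\<close> in a denominator.\<close>

lemma KL_bernoulli_ge:
  assumes "0 < p" "p < 1 / 2"
  shows "(1 - 2 * p)\<^sup>2 \<le> KL_bernoulli p (1 - p)"
proof -
  have "KL_bernoulli p (1 - p) = (1 - 2 * p) * - ln (p / (1 - p))"
    using assms by (simp add: KL_bernoulli_def ln_div algebra_simps)
  moreover have "1 - 2 * p \<le> - ln (p / (1 - p))"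
  proof -
    have "ln (p / (1 - p)) \<le> p / (1 - p) - 1" using assms by (intro ln_le_minus_one) auto
    also have "\<dots> = - ((1 - 2 * p) / (1 - p))" using assms by (simp add: field_simps)
    also have "\<dots> \<le> - ((1 - 2 * p) / 1)"
      unfolding neg_le_iff_le using assms by (intro divide_left_mono) auto
    finally show ?thesis by simp
  qed
  then have "(1 - 2 * p) * (1 - 2 * p) \<le> (1 - 2 * p) * - ln (p / (1 - p))"
    using assms by (intro mult_left_mono) auto
  ultimately show ?thesis unfolding power2_eq_square by linarith
qed

theorem theorem2:
  "\<exists>c>0. \<forall>(n::nat) (k::nat) (p::real) \<C> A.
     2 \<le> k \<and> k < n \<and> 0 \<le> p \<and> p < 1 / 2 \<and>
     (\<C> = max_bounded_clusterings n k \<or> \<C> = min_bounded_clusterings n k) \<and>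
     randomized_algorithm n A \<and>
     (\<forall>P\<in>\<C>. success_prob p P A \<ge> 0.9) \<longrightarrow>
     (p > 0 \<longrightarrow>
       (\<exists>P\<in>\<C>. expected_queries p P A \<ge> c * (real n * real k / KL_bernoulli p (1 - p)))) \<and>
     (p = 0 \<longrightarrow>
       (\<exists>P\<in>\<C>. expected_queries p P A \<ge> c * (real n * real k)))"
proof (rule exI[of _ "1 / 10000"], intro conjI allI impI, goal_cases)
  case (2 n k p \<C> A)
  then obtain P where P: "P \<in> \<C>" "real n * real k / (10000 * (1 - 2 * p)\<^sup>2) \<le> expected_queries p P A"
    using many_clusters_lower_bound[of p k n A \<C>] few_clusters_lower_bound[of p k n A \<C>]
    by (cases "4 * n < 5 * k") (auto simp: not_less)
  have "real n * real k / KL_bernoulli p (1 - p) \<le> real n * real k / (1 - 2 * p)\<^sup>2"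
    using KL_bernoulli_ge[of p] 2 by (intro frac_le) auto
  then have "1 / 10000 * (real n * real k / KL_bernoulli p (1 - p)) \<le>
      1 / 10000 * (real n * real k / (1 - 2 * p)\<^sup>2)" by (rule mult_left_mono) simp
  also have "\<dots> = real n * real k / (10000 * (1 - 2 * p)\<^sup>2)" by simp
  also note P(2)
  finally have "1 / 10000 * (real n * real k / KL_bernoulli p (1 - p)) \<le> expected_queries p P A" .
  then show ?case using P(1) by blast
next
  \<comment> \<open>At \<open>p = 0\<close> the factor \<open>(1 - 2 * p)\<^sup>2\<close> is 1, and
    no divergence enters.\<close>
  case (3 n k p \<C> A)
  then obtain P where "P \<in> \<C>" "real n * real k / (10000 * (1 - 2 * p)\<^sup>2) \<le> expected_queries p P A"
    using many_clusters_lower_bound[of p k n A \<C>] few_clusters_lower_bound[of p k n A \<C>]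
    by (cases "4 * n < 5 * k") (auto simp: not_less)
  then show ?case using 3 by (intro bexI[of _ P]) auto
qed simp

end
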